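(* With the groups, homogeneous spaces and coordinates of the context: (1) The action $G^J(\mathbb{R})_0\times\mathcal{X}^J_1\to\mathcal{X}^J_1$ is given by $(M,X)\times(\tau',z')=(\tau_1,z_1)$, where $$\tau_1=\frac{a\tau'+b}{c\tau'+d},\qquad z_1=\frac{z'+\lambda\tau'+\mu}{c\tau'+d}.$$ In the coordinates $(x,y,p,q)$ it is $(M,X)\times(x',y',p',q')=(x_1,y_1,p_1,q_1)$, where $$x_1+\mathrm{i}y_1=\frac{(ax'+b)(cx'+d)+acy'^2+\mathrm{i}y'}{(cx'+d)^2+(cy')^2},$$ $$(p_1,q_1)=(p,q)+(p',q')\begin{pmatrix}a&b\\ c&d\end{pmatrix}^{-1}=(p+dp'-cq',\ q-bp'+aq'),\qquad (p,q)=XM^{-1}.$$ (2) The action $G^J_1(\mathbb{R})\times\tilde{\mathcal{X}}^J_1\to\tilde{\mathcal{X}}^J_1$ is given by $(M,X,\kappa)\times(\tau',z',\kappa')=(\tau_1,z_1,\kappa_1)$, equivalently $(M,X,\kappa)\times(x',y',p',q',\kappa')=(x_1,y_1,p_1,q_1,\kappa_1)$, with $\tau_1,z_1,x_1,y_1,p_1,q_1$ as in (1) and $$\kappa_1=\kappa+\kappa'+\lambda q'-\mu p',\qquad (p',q')=\Big(\frac{\eta'}{y'},\ \xi'-\frac{x'}{y'}\eta'\Big),$$ where $z'=\xi'+\mathrm{i}\eta'$.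
   Context: The real Jacobi group $G^J_1(\mathbb{R})$ consists of triples $(M,X,\kappa)$, $M=\begin{pmatrix}a&b\\ c&d\end{pmatrix}\in\mathrm{SL}(2,\mathbb{R})$, $X=(\lambda,\mu)\in\mathbb{R}^2$, $\kappa\in\mathbb{R}$, with product $(M,X,\kappa)(M',X',\kappa')=\big(MM',\,XM'+X',\,\kappa+\kappa'+\det\begin{pmatrix}XM'\\ X'\end{pmatrix}\big)$. $G^J(\mathbb{R})_0$ is the quotient group of pairs $(M,X)$, with product $(MM',XM'+X')$. Put $(p,q):=XM^{-1}$ and let $(x,y,\theta)$ be the Iwasawa coordinates of $M$, i.e. $M=\begin{pmatrix}1&x\\ 0&1\end{pmatrix}\begin{pmatrix}y^{1/2}&0\\ 0&y^{-1/2}\end{pmatrix}\begin{pmatrix}\cos\theta&\sin\theta\\ -\sin\theta&\cos\theta\end{pmatrix}$, $y>0$. The Siegel--Jacobi upper half-plane is $\mathcal{X}^J_1=G^J(\mathbb{R})_0/\mathrm{SO}(2)\cong\mathcal{X}_1\times\mathbb{R}^2$, with coordinates $(x,y,p,q)$; the extended Siegel--Jacobi upper half-plane is $\tilde{\mathcal{X}}^J_1=G^J_1(\mathbb{R})/\mathrm{SO}(2)\cong\mathcal{X}^J_1\times\mathbb{R}$, with coordinates $(x,y,p,q,\kappa)$; here $\mathrm{SO}(2)$ consists of the elements with $M\in\mathrm{SO}(2)$, $X=0$ (and $\kappa=0$), and the actions are those induced by left multiplication. Here $\mathcal{X}_1=\{\tau\in\mathbb{C}:\operatorname{Im}\tau>0\}$.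 Complex coordinates: $\tau=x+\mathrm{i}y$, $z=p\tau+q=\xi+\mathrm{i}\eta$ with $\xi,\eta\in\mathbb{R}$ (and likewise with primes or subscript $1$). *)

theory Defs
  imports
    "HOL-Analysis.Analysis"
    "HOL-Algebra.Group_Action"
    "HOL-Algebra.Left_Coset"
begin

text \<open>
  Elements \<open>X = (\<lambda>, \<mu>)\<close> of the plane are row vectors, so that \<open>X M\<close> is \<open>X v* M\<close>.
\<close>

definition jacobi_group0 :: "((real^2^2) \<times> (real^2)) monoid" where
  "jacobi_group0 =
    \<lparr>carrier = {(M, X). det M = 1},
     mult = (\<lambda>(M, X) (M', X'). (M ** M', X v* M' + X')),
     one = (mat 1, 0)\<rparr>"

definition jacobi_group1 :: "((real^2^2) \<times> (real^2) \<times> real) monoid" where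
  "jacobi_group1 =
    \<lparr>carrier = {(M, X, \<kappa>). det M = 1},
     mult = (\<lambda>(M, X, \<kappa>) (M', X', \<kappa>').
       (M ** M', X v* M' + X', \<kappa> + \<kappa>' + det (vector [X v* M', X'] :: real^2^2))),
     one = (mat 1, 0, 0)\<rparr>"

definition SO2_in_group0 :: "((real^2^2) \<times> (real^2)) set" where
  "SO2_in_group0 = {(R, X). rotation_matrix R \<and> X = 0}"

definition SO2_in_group1 :: "((real^2^2) \<times> (real^2) \<times> real) set" where
  "SO2_in_group1 = {(R, X, \<kappa>). rotation_matrix R \<and> X = 0 \<and> \<kappa> = 0}"

definition SJ_space :: "((real^2^2) \<times> (real^2)) set set" where
  "SJ_space = lcosets\<^bsub>jacobi_group0\<^esub> SO2_in_group0"

definition ext_SJ_space :: "((real^2^2) \<times> (real^2) \<times> real) set set" where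
  "ext_SJ_space = lcosets\<^bsub>jacobi_group1\<^esub> SO2_in_group1"

text \<open>
  The restriction to the coset space only makes the maps extensional, as \<^const>\<open>BijGroup\<close> requires.
\<close>

definition SJ_action ::
  "(real^2^2) \<times> (real^2) \<Rightarrow> ((real^2^2) \<times> (real^2)) set \<Rightarrow> ((real^2^2) \<times> (real^2)) set" where
  "SJ_action g = (\<lambda>P\<in>SJ_space. g <#\<^bsub>jacobi_group0\<^esub> P)"

definition ext_SJ_action ::
  "(real^2^2) \<times> (real^2) \<times> real \<Rightarrow> ((real^2^2) \<times> (real^2) \<times> real) set
    \<Rightarrow> ((real^2^2) \<times> (real^2) \<times> real) set" where
  "ext_SJ_action g = (\<lambda>P\<in>ext_SJ_space. g <#\<^bsub>jacobi_group1\<^esub> P)"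

definition iwasawa :: "real^2^2 \<Rightarrow> real \<Rightarrow> real \<Rightarrow> real \<Rightarrow> bool" where
  "iwasawa M x y \<theta> \<longleftrightarrow> y > 0 \<and>
     M = (vector [vector [1, x], vector [0, 1]] :: real^2^2)
         ** (vector [vector [sqrt y, 0], vector [0, 1 / sqrt y]] :: real^2^2)
         ** (vector [vector [cos \<theta>, sin \<theta>], vector [- sin \<theta>, cos \<theta>]] :: real^2^2)"

text \<open>
  The coordinates of a coset are read off from any of its elements: \<open>x, y\<close> are the first two
  Iwasawa coordinates of \<open>M\<close> and \<open>(p, q) = X M\<^sup>-\<^sup>1\<close>. Only \<open>\<theta>\<close> depends on the chosen
  representative (and is itself determined only modulo \<open>2\<pi>\<close>).
\<close>

definition SJ_coords :: "((real^2^2) \<times> (real^2)) set \<Rightarrow> real \<times> real \<times> real \<times> real" where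
  "SJ_coords P = (THE (x, y, p, q). \<exists>M X \<theta>.
     (M, X) \<in> P \<and> iwasawa M x y \<theta> \<and> vector [p, q] = X v* matrix_inv M)"

definition ext_SJ_coords ::
  "((real^2^2) \<times> (real^2) \<times> real) set \<Rightarrow> real \<times> real \<times> real \<times> real \<times> real" where
  "ext_SJ_coords P = (THE (x, y, p, q, \<kappa>). \<exists>M X \<theta>.
     (M, X, \<kappa>) \<in> P \<and> iwasawa M x y \<theta> \<and> vector [p, q] = X v* matrix_inv M)"

definition SJ_complex_coords :: "((real^2^2) \<times> (real^2)) set \<Rightarrow> complex \<times> complex" where
  "SJ_complex_coords P = (case SJ_coords P of (x, y, p, q) \<Rightarrow>
     (Complex x y, of_real p * Complex x y + of_real q))"

definition ext_SJ_complex_coords ::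
  "((real^2^2) \<times> (real^2) \<times> real) set \<Rightarrow> complex \<times> complex \<times> real" where
  "ext_SJ_complex_coords P = (case ext_SJ_coords P of (x, y, p, q, \<kappa>) \<Rightarrow>
     (Complex x y, of_real p * Complex x y + of_real q, \<kappa>))"

end

theory Submission
  imports Defs
begin

text \<open>
  A matrix \<open>M\<close> of determinant one moves the point \<open>i\<close> of the upper half-plane to \<open>x + i y\<close>, where
  \<open>x, y\<close> are its first two Iwasawa coordinates, and the stabiliser of \<open>i\<close> is the rotation group.
  Right multiplication by a rotation \<open>R\<close> therefore changes neither \<open>x, y\<close>, nor
  \<open>(p, q) = X M\<^sup>-\<^sup>1\<close>, nor \<open>\<kappa>\<close>, as the symplectic form in the group law vanishes against zero. So
  these quantities are functions on the coset spaces. They separate the cosets and take all values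
  with \<open>y > 0\<close>, since every coset contains exactly one element whose matrix is the upper triangular
  matrix \<open>T = upper_tri x y\<close>, and it is \<open>(T, (p, q) T)\<close>, extended by \<open>\<kappa>\<close>. This is the content of
  \<open>bij_betw_lcosets_section\<close>, applied to the map that sends coordinates to that representative.

  To find the action in coordinates, it is enough to multiply a group element by the representative
  of a coset and to read off the coordinates of the product (\<open>coords_left_mult_section\<close>). The
  half-plane coordinate transforms by the Moebius action (\<open>iwasawa_xy_mult_upper_tri\<close>). The row
  \<open>(p', q')\<close> turns into \<open>(p, q) + (p', q') M\<^sup>-\<^sup>1\<close> (\<open>group0_coords_mult_section0\<close>). Pairing that row
  with the column \<open>(\<tau>, 1)\<close>, which \<open>M\<close> transforms up to the factor \<open>c \<tau> + d\<close>, gives the law for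
  \<open>z\<close> (\<open>moebius_fibre_coord\<close>). Finally \<open>\<kappa>\<close> gains the symplectic form of \<open>(\<lambda>, \<mu>) T\<close> and
  \<open>(p', q') T\<close>, which is that of \<open>(\<lambda>, \<mu>)\<close> and \<open>(p', q')\<close> because \<open>det T = 1\<close>
  (\<open>group1_coords_mult_section1\<close>).
\<close>


section \<open>Left multiplication on the left cosets of a subgroup\<close>

context group
begin

lemma lcosetsI: "g \<in> carrier G \<Longrightarrow> g <#\<^bsub>G\<^esub> H \<in> lcosets H"
  by (auto simp: LCOSETS_def)

lemma lcosetsE:
  assumes "P \<in> lcosets H"
  obtains g where "g \<in> carrier G" "P = g <#\<^bsub>G\<^esub> H"
  using assms by (auto simp: LCOSETS_def)

text \<open>
  Left multiplication by \<open>g\<close> permutes the cosets because left multiplication by \<open>g\<^sup>-\<^sup>1\<close>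
  undoes it, and it is compatible with products because \<open>g (h P) = (g h) P\<close>.
\<close>

lemma group_action_lcosets:
  assumes H: "subgroup H G"
  shows "group_action G (lcosets H) (\<lambda>g. \<lambda>P\<in>lcosets H. g <#\<^bsub>G\<^esub> P)"
proof -
  have HG: "H \<subseteq> carrier G"
    using H by (rule subgroup.subset)
  have sub: "P \<subseteq> carrier G" if "P \<in> lcosets H" for P
    using subgroup.lcosets_carrier[OF H is_group that] .
  have closed: "g <#\<^bsub>G\<^esub> P \<in> lcosets H" if "g \<in> carrier G" "P \<in> lcosets H" for g P
    using that by (auto elim!: lcosetsE simp: lcos_m_assoc HG intro!: lcosetsI)
  have bij: "bij_betw (\<lambda>P\<in>lcosets H. g <#\<^bsub>G\<^esub> P) (lcosets H) (lcosets H)"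
    if g: "g \<in> carrier G" for g
    by (rule bij_betw_byWitness[where f' = "\<lambda>P. inv g <#\<^bsub>G\<^esub> P"])
       (auto simp: closed g lcos_m_assoc lcos_mult_one sub)
  have Bij: "(\<lambda>P\<in>lcosets H. g <#\<^bsub>G\<^esub> P) \<in> Bij (lcosets H)" if "g \<in> carrier G" for g
    using bij[OF that] by (simp add: Bij_def)
  have "(\<lambda>P\<in>lcosets H. (g \<otimes> h) <#\<^bsub>G\<^esub> P)
      = compose (lcosets H) (\<lambda>P\<in>lcosets H. g <#\<^bsub>G\<^esub> P) (\<lambda>P\<in>lcosets H. h <#\<^bsub>G\<^esub> P)"
    if "g \<in> carrier G" "h \<in> carrier G" for g h
    using that by (auto simp: compose_def fun_eq_iff lcos_m_assoc sub closed)
  then have "(\<lambda>g. \<lambda>P\<in>lcosets H. g <#\<^bsub>G\<^esub> P) \<in> hom G (BijGroup (lcosets H))"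
    by (auto simp: hom_def BijGroup_def Bij)
  then show ?thesis
    by (auto simp: group_action_def group_hom_def group_hom_axioms_def group_BijGroup)
qed

text \<open>
  How a coset space acquires global coordinates. The coordinates are given on group elements by
  a map \<open>f\<close>, and a section \<open>s\<close> of \<open>f\<close> picks a standard representative of every coset; then
  \<open>v \<mapsto> s v H\<close> inverts the coordinate map.
\<close>

lemma bij_betw_lcosets_section:
  assumes "\<And>g. g \<in> carrier G \<Longrightarrow> coords (g <#\<^bsub>G\<^esub> H) = f g"
    and "\<And>g. g \<in> carrier G \<Longrightarrow> f g \<in> S"
    and "\<And>v. v \<in> S \<Longrightarrow> s v \<in> carrier G"
    and "\<And>v. v \<in> S \<Longrightarrow> f (s v) = v"
    and "\<And>g. g \<in> carrier G \<Longrightarrow> s (f g) <#\<^bsub>G\<^esub> H = g <#\<^bsub>G\<^esub> H"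
  shows "bij_betw coords (lcosets H) S"
  by (rule bij_betw_byWitness[where f' = "\<lambda>v. s v <#\<^bsub>G\<^esub> H"])
     (auto elim!: lcosetsE simp: assms intro!: lcosetsI)

text \<open>
  To follow the action in such coordinates, it suffices to multiply \<open>g\<close> with the standard
  representative of the coset and to read off the coordinates of the product.
\<close>

lemma coords_left_mult_section:
  assumes "subgroup H G"
    and "\<And>g. g \<in> carrier G \<Longrightarrow> coords (g <#\<^bsub>G\<^esub> H) = f g"
    and "\<And>g. g \<in> carrier G \<Longrightarrow> f g \<in> S"
    and "\<And>v. v \<in> S \<Longrightarrow> s v \<in> carrier G"
    and "\<And>g. g \<in> carrier G \<Longrightarrow> s (f g) <#\<^bsub>G\<^esub> H = g <#\<^bsub>G\<^esub> H"
    and g: "g \<in> carrier G" and P: "P \<in> lcosets H"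
  shows "coords (g <#\<^bsub>G\<^esub> P) = f (g \<otimes> s (coords P))"
proof -
  obtain k where k: "k \<in> carrier G" and Pk: "P = k <#\<^bsub>G\<^esub> H"
    using P by (rule lcosetsE)
  have "s (f k) \<in> carrier G"
    using k by (simp add: assms)
  moreover have "P = s (f k) <#\<^bsub>G\<^esub> H"
    by (simp add: Pk k assms)
  ultimately have "g <#\<^bsub>G\<^esub> P = (g \<otimes> s (f k)) <#\<^bsub>G\<^esub> H"
    by (simp add: lcos_m_assoc g subgroup.subset[OF assms(1)])
  moreover have "f k = coords P"
    by (simp add: Pk k assms)
  moreover have "g \<otimes> s (f k) \<in> carrier G"
    using g k by (simp add: assms)
  ultimately show ?thesis
    by (simp add: assms(2))
qed

end


section \<open>Real two-by-two matrices of determinant one\<close>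

lemmas mat2_simps =
  vec_eq_iff forall_2 sum_2 det_2 matrix_matrix_mult_def vector_matrix_mult_def
  transpose_def mat_def

text \<open>
  The determinant of two rows is the symplectic form of the plane, and matrices of determinant
  one preserve it. This makes the product of the extended Jacobi group associative, and it
  lets the term in \<open>\<kappa>\<close> be computed after stripping a common factor from both rows.
\<close>

lemma det_vector_rows_mult:
  fixes M :: "real^2^2" and X Y :: "real^2"
  shows "det (vector [X v* M, Y v* M] :: real^2^2) = det (vector [X, Y] :: real^2^2) * det M"
  by (simp add: mat2_simps) algebra

lemma det_vector_dependent_rows [simp]:
  fixes X :: "real^2"
  shows "det (vector [X, 0] :: real^2^2) = 0" "det (vector [0, X] :: real^2^2) = 0"
    "det (vector [- X, X] :: real^2^2) = 0"
  by (simp_all add: det_2)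

lemma det_1_inverse:
  fixes M :: "real^2^2"
  assumes "det M = 1"
  shows "M ** matrix_inv M = mat 1" "matrix_inv M ** M = mat 1"
proof -
  have "invertible M"
    using assms by (simp add: invertible_det_nz)
  then have "\<exists>A. M ** A = mat 1 \<and> A ** M = mat 1"
    by (simp add: invertible_def)
  then have "M ** matrix_inv M = mat 1 \<and> matrix_inv M ** M = mat 1"
    unfolding matrix_inv_def by (rule someI_ex)
  then show "M ** matrix_inv M = mat 1" "matrix_inv M ** M = mat 1"
    by auto
qed

lemma det_matrix_inv_1:
  fixes M :: "real^2^2"
  assumes "det M = 1"
  shows "det (matrix_inv M) = 1"
  using det_mul[of M "matrix_inv M"] det_1_inverse[OF assms] assms by simp

text \<open>
  Trading the inverse for a product keeps its entries out of all later arguments except the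
  final formulas, for which the next lemma provides them.
\<close>

lemma vector_matrix_inv_eq_iff:
  fixes M :: "real^2^2" and X Y :: "real^2"
  assumes "det M = 1"
  shows "X v* matrix_inv M = Y \<longleftrightarrow> X = Y v* M"
  by (metis assms det_1_inverse vector_matrix_mul_assoc vector_matrix_mul_rid)

lemma vector_matrix_inv_2:
  fixes a b c d u v :: real
  assumes "a * d - b * c = 1"
  shows "vector [u, v] v* matrix_inv (vector [vector [a, b], vector [c, d]] :: real^2^2)
    = (vector [u * d - v * c, v * a - u * b] :: real^2)"
proof -
  have "u = (u * d - v * c) * a + (v * a - u * b) * c"
    and "v = (u * d - v * c) * b + (v * a - u * b) * d"
    using assms by algebra+
  then show ?thesis
    using assms by (subst vector_matrix_inv_eq_iff) (simp_all add: mat2_simps)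
qed


section \<open>Iwasawa coordinates\<close>

text \<open>
  The product of the unipotent and the diagonal factor of the Iwasawa decomposition.
\<close>

definition upper_tri :: "real \<Rightarrow> real \<Rightarrow> real^2^2" where
  "upper_tri x y = vector [vector [sqrt y, x / sqrt y], vector [0, 1 / sqrt y]]"

definition rotation2 :: "real \<Rightarrow> real^2^2" where
  "rotation2 \<theta> = vector [vector [cos \<theta>, sin \<theta>], vector [- sin \<theta>, cos \<theta>]]"

lemma iwasawa_iff: "iwasawa M x y \<theta> \<longleftrightarrow> y > 0 \<and> M = upper_tri x y ** rotation2 \<theta>"
proof -
  have "(vector [vector [1, x], vector [0, 1]] :: real^2^2)
      ** vector [vector [sqrt y, 0], vector [0, 1 / sqrt y]] = upper_tri x y"
    by (simp add: upper_tri_def mat2_simps)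
  then show ?thesis
    by (simp add: iwasawa_def rotation2_def)
qed

lemma det_upper_tri: "y > 0 \<Longrightarrow> det (upper_tri x y) = 1"
  by (simp add: upper_tri_def det_2)

lemma rotation_matrix_rotation2: "rotation_matrix (rotation2 \<theta>)"
  by (simp add: rotation_matrix_def orthogonal_matrix rotation2_def mat2_simps
      power2_eq_square[symmetric])

text \<open>
  The point \<open>x + i y = (a i + b) / (c i + d)\<close> of the upper half-plane into which a matrix of
  determinant one moves \<open>i\<close>, written in terms of the inner products of the rows \<open>(a, b)\<close> and
  \<open>(c, d)\<close>. In this form invariance under right multiplication by rotations is evident.
\<close>

definition iwasawa_xy :: "real^2^2 \<Rightarrow> real \<times> real" where
  "iwasawa_xy M = (M $ 1 \<bullet> M $ 2 / (M $ 2 \<bullet> M $ 2), 1 / (M $ 2 \<bullet> M $ 2))"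

text \<open>
  The inner products of the rows are the entries of \<open>M M\<^sup>T\<close>, and \<open>(M R) (M R)\<^sup>T = M M\<^sup>T\<close> for
  orthogonal \<open>R\<close>.
\<close>

lemma inner_rows_mult_rotation:
  fixes M R :: "real^2^2"
  assumes "rotation_matrix R"
  shows "(M ** R) $ i \<bullet> (M ** R) $ j = M $ i \<bullet> M $ j"
proof -
  have RR: "R ** transpose R = mat 1"
    using assms by (simp add: rotation_matrix_def orthogonal_matrix_def)
  have row: "(A ** transpose B) $ i $ j = A $ i \<bullet> B $ j" for A B :: "real^2^2"
    by (simp add: matrix_matrix_mult_def transpose_def inner_vec_def)
  have "(M ** R) ** transpose (M ** R) = M ** (R ** transpose R) ** transpose M"
    by (simp add: matrix_transpose_mul matrix_mul_assoc)
  then have "(M ** R) ** transpose (M ** R) = M ** transpose M"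
    by (simp add: RR)
  then show ?thesis
    by (metis row)
qed

lemma iwasawa_xy_mult_rotation: "rotation_matrix R \<Longrightarrow> iwasawa_xy (M ** R) = iwasawa_xy M"
  by (simp add: iwasawa_xy_def inner_rows_mult_rotation)

lemma iwasawa_xy_upper_tri:
  assumes "y > 0"
  shows "iwasawa_xy (upper_tri x y) = (x, y)"
  using assms by (simp add: iwasawa_xy_def upper_tri_def inner_vec_def sum_2 field_simps)

lemma row_2_pos:
  assumes "det (M :: real^2^2) = 1"
  shows "M $ 2 \<bullet> M $ 2 > 0"
  using assms by (auto simp: det_2)

text \<open>
  The angle is dictated by the bottom row of \<open>M\<close>, which in an Iwasawa decomposition is
  \<open>(- sin \<theta>, cos \<theta>) / sqrt y\<close>. The top row then comes out right because
  \<open>det M = 1\<close> determines it from the bottom row and its inner product with the bottom row.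
\<close>

lemma iwasawa_exists:
  fixes M :: "real^2^2"
  assumes M: "det M = 1" and xy: "iwasawa_xy M = (x, y)"
  shows "\<exists>\<theta>. iwasawa M x y \<theta>"
proof -
  define a b c d where abcd: "a = M $ 1 $ 1" "b = M $ 1 $ 2" "c = M $ 2 $ 1" "d = M $ 2 $ 2"
  have det: "a * d - b * c = 1"
    using M by (simp add: det_2 abcd)
  define n where "n = c^2 + d^2"
  have n: "n > 0"
    using row_2_pos[OF M] by (simp add: n_def abcd inner_vec_def sum_2 power2_eq_square)
  have x: "x = (a * c + b * d) / n" and y: "y = 1 / n"
    using xy by (simp_all add: iwasawa_xy_def inner_vec_def sum_2 abcd n_def power2_eq_square)
  have "(d / sqrt n)\<^sup>2 + (- c / sqrt n)\<^sup>2 = 1"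
    using n by (simp add: power_divide add_divide_distrib[symmetric]) (simp add: n_def)
  then obtain \<theta> where "d / sqrt n = cos \<theta>" "- c / sqrt n = sin \<theta>"
    by (rule sincos_total_2pi)
  then have cos: "cos \<theta> = d / sqrt n" and sin: "sin \<theta> = - c / sqrt n"
    by simp_all
  \<comment> \<open>The components of the top row along the bottom row and orthogonal to it.\<close>
  have "a * n = d + (a * c + b * d) * c" "b * n = (a * c + b * d) * d - c"
    using det unfolding n_def by algebra+
  then have "a = (d + (a * c + b * d) * c) / n" "b = ((a * c + b * d) * d - c) / n"
    using n by (simp_all add: eq_divide_eq)
  then have "a = d / n + x * c" "b = x * d - c / n"
    by (simp_all add: x flip: add_divide_distrib diff_divide_distrib)
  then have "M = upper_tri x y ** rotation2 \<theta>"
    using n by (simp add: mat2_simps upper_tri_def rotation2_def cos sin y real_sqrt_divide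
        flip: abcd)
  moreover have "y > 0"
    using n by (simp add: y)
  ultimately show ?thesis
    by (auto simp: iwasawa_iff)
qed

text \<open>
  Existence and uniqueness of the first two Iwasawa coordinates: whatever the angle, they can
  only be \<open>iwasawa_xy M\<close>, by rotation invariance.
\<close>

lemma ex_iwasawa_iff:
  assumes "det M = 1"
  shows "(\<exists>\<theta>. iwasawa M x y \<theta>) \<longleftrightarrow> iwasawa_xy M = (x, y)"
  using iwasawa_exists[OF assms]
  by (auto simp: iwasawa_iff iwasawa_xy_mult_rotation rotation_matrix_rotation2 iwasawa_xy_upper_tri)

text \<open>
  Since \<open>upper_tri x y\<close> moves \<open>i\<close> to \<open>x + i y\<close>, this is the Moebius action of a real matrix on
  \<open>x + i y\<close>, separated into real and imaginary part when the determinant is one.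
\<close>

lemma iwasawa_xy_mult_upper_tri:
  fixes a b c d x y :: real
  assumes "y > 0"
  shows "iwasawa_xy (vector [vector [a, b], vector [c, d]] ** upper_tri x y)
    = (((a * x + b) * (c * x + d) + a * c * y^2) / ((c * x + d)^2 + (c * y)^2),
       y / ((c * x + d)^2 + (c * y)^2))"
proof -
  define M :: "real^2^2" where "M = vector [vector [a, b], vector [c, d]] ** upper_tri x y"
  have M1: "M $ 1 = vector [a * y, a * x + b] /\<^sub>R sqrt y"
   and M2: "M $ 2 = vector [c * y, c * x + d] /\<^sub>R sqrt y"
    using assms by (simp_all add: M_def upper_tri_def mat2_simps field_simps)
  have "M $ 2 \<bullet> M $ 2 = ((c * x + d)^2 + (c * y)^2) / y"
    using assms by (simp add: M2 inner_vec_def sum_2 field_simps power2_eq_square)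
  moreover have "M $ 1 \<bullet> M $ 2 = ((a * x + b) * (c * x + d) + a * c * y^2) / y"
    using assms by (simp add: M1 M2 inner_vec_def sum_2 field_simps power2_eq_square)
  ultimately show ?thesis
    using assms by (simp add: iwasawa_xy_def flip: M_def)
qed

section \<open>The Jacobi groups and their subgroups of rotations\<close>

lemma group_jacobi_group0: "group jacobi_group0"
proof (rule groupI)
  fix g assume "g \<in> carrier jacobi_group0"
  then obtain M X where g: "g = (M, X)" and M: "det M = 1"
    by (auto simp: jacobi_group0_def)
  have "(matrix_inv M, - X v* matrix_inv M) \<in> carrier jacobi_group0"
    by (simp add: jacobi_group0_def det_matrix_inv_1 M)
  moreover have "(matrix_inv M, - X v* matrix_inv M) \<otimes>\<^bsub>jacobi_group0\<^esub> g = \<one>\<^bsub>jacobi_group0\<^esub>"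
    by (simp add: jacobi_group0_def g vector_matrix_mul_assoc det_1_inverse M)
  ultimately show "\<exists>h\<in>carrier jacobi_group0. h \<otimes>\<^bsub>jacobi_group0\<^esub> g = \<one>\<^bsub>jacobi_group0\<^esub>"
    by blast
qed (auto simp: jacobi_group0_def det_mul matrix_mul_assoc vector_matrix_mul_assoc
      vector_matrix_left_distrib)

text \<open>
  The summand \<open>det (X M', X')\<close> is a 2-cocycle: after moving \<open>M''\<close> into the determinant, which its
  own determinant one permits, both bracketings give the same sum of three symplectic forms.
\<close>

lemma group_jacobi_group1: "group jacobi_group1"
proof (rule groupI)
  fix g assume "g \<in> carrier jacobi_group1"
  then obtain M X \<kappa> where g: "g = (M, X, \<kappa>)" and M: "det M = 1"
    by (auto simp: jacobi_group1_def)
  have "(matrix_inv M, - X v* matrix_inv M, - \<kappa>) \<in> carrier jacobi_group1"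
    by (simp add: jacobi_group1_def det_matrix_inv_1 M)
  moreover have "(matrix_inv M, - X v* matrix_inv M, - \<kappa>) \<otimes>\<^bsub>jacobi_group1\<^esub> g
      = \<one>\<^bsub>jacobi_group1\<^esub>"
    by (simp add: jacobi_group1_def g vector_matrix_mul_assoc det_1_inverse M)
  ultimately show "\<exists>h\<in>carrier jacobi_group1. h \<otimes>\<^bsub>jacobi_group1\<^esub> g = \<one>\<^bsub>jacobi_group1\<^esub>"
    by blast
next
  fix g h k
  assume "g \<in> carrier jacobi_group1" "h \<in> carrier jacobi_group1" "k \<in> carrier jacobi_group1"
  then obtain M X \<kappa> M' X' \<kappa>' M'' X'' \<kappa>''
    where ghk: "g = (M, X, \<kappa>)" "h = (M', X', \<kappa>')" "k = (M'', X'', \<kappa>'')"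
      and M'': "det M'' = 1"
    by (auto simp: jacobi_group1_def)
  have "det (vector [X v* M', X'] :: real^2^2)
      = det (vector [X v* M' v* M'', X' v* M''] :: real^2^2)"
    by (simp add: det_vector_rows_mult M'')
  then show "g \<otimes>\<^bsub>jacobi_group1\<^esub> h \<otimes>\<^bsub>jacobi_group1\<^esub> k
      = g \<otimes>\<^bsub>jacobi_group1\<^esub> (h \<otimes>\<^bsub>jacobi_group1\<^esub> k)"
    by (simp add: ghk jacobi_group1_def matrix_mul_assoc vector_matrix_left_distrib
        vector_matrix_mul_assoc)
       (simp add: det_2 algebra_simps)
qed (auto simp: jacobi_group1_def det_mul)

lemma rotation_matrix_mult:
  fixes R R' :: "real^2^2"
  shows "rotation_matrix R \<Longrightarrow> rotation_matrix R' \<Longrightarrow> rotation_matrix (R ** R')"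
  by (simp add: rotation_matrix_def orthogonal_matrix_mul det_mul)

lemma rotation_matrix_transpose:
  fixes R :: "real^2^2"
  shows "rotation_matrix R \<Longrightarrow> rotation_matrix (transpose R)"
  by (simp add: rotation_matrix_def orthogonal_matrix_transpose)

lemma rotation_transpose_mult:
  fixes R :: "real^2^2"
  shows "rotation_matrix R \<Longrightarrow> transpose R ** R = mat 1"
  by (simp add: rotation_matrix_def orthogonal_matrix)

lemma subgroup_SO2_group0: "subgroup SO2_in_group0 jacobi_group0"
proof (rule group.subgroupI[OF group_jacobi_group0])
  fix g assume "g \<in> SO2_in_group0"
  then obtain R where R: "rotation_matrix R" and g: "g = (R, 0)"
    by (auto simp: SO2_in_group0_def)
  then have "inv\<^bsub>jacobi_group0\<^esub> g = (transpose R, 0)"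
    by (intro group.inv_equality[OF group_jacobi_group0])
       (use rotation_matrix_transpose[OF R] in
         \<open>simp_all add: jacobi_group0_def rotation_transpose_mult rotation_matrix_def\<close>)
  then show "inv\<^bsub>jacobi_group0\<^esub> g \<in> SO2_in_group0"
    using R by (simp add: SO2_in_group0_def rotation_matrix_transpose)
next
  have "(mat 1, 0) \<in> SO2_in_group0"
    by (simp add: SO2_in_group0_def rotation_matrix_def orthogonal_matrix_id)
  then show "SO2_in_group0 \<noteq> {}"
    by blast
qed (auto simp: SO2_in_group0_def jacobi_group0_def rotation_matrix_mult,
     auto simp: rotation_matrix_def)

lemma subgroup_SO2_group1: "subgroup SO2_in_group1 jacobi_group1"
proof (rule group.subgroupI[OF group_jacobi_group1])
  fix g assume "g \<in> SO2_in_group1"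
  then obtain R where R: "rotation_matrix R" and g: "g = (R, 0, 0)"
    by (auto simp: SO2_in_group1_def)
  then have "inv\<^bsub>jacobi_group1\<^esub> g = (transpose R, 0, 0)"
    by (intro group.inv_equality[OF group_jacobi_group1])
       (use rotation_matrix_transpose[OF R] in
         \<open>simp_all add: jacobi_group1_def rotation_transpose_mult rotation_matrix_def\<close>)
  then show "inv\<^bsub>jacobi_group1\<^esub> g \<in> SO2_in_group1"
    using R by (simp add: SO2_in_group1_def rotation_matrix_transpose)
next
  have "(mat 1, 0, 0) \<in> SO2_in_group1"
    by (simp add: SO2_in_group1_def rotation_matrix_def orthogonal_matrix_id)
  then show "SO2_in_group1 \<noteq> {}"
    by blast
qed (auto simp: SO2_in_group1_def jacobi_group1_def rotation_matrix_mult,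
     auto simp: rotation_matrix_def)

lemma mem_lcoset_group0:
  "(N, Y) \<in> (M, X) <#\<^bsub>jacobi_group0\<^esub> SO2_in_group0
    \<longleftrightarrow> (\<exists>R. rotation_matrix R \<and> N = M ** R \<and> Y = X v* R)"
  by (auto simp: l_coset_def jacobi_group0_def SO2_in_group0_def)

text \<open>
  The coordinate \<open>\<kappa>\<close> is constant on a coset, since the cocycle vanishes when the second factor
  has \<open>X' = 0\<close>.
\<close>

lemma mem_lcoset_group1:
  "(N, Y, k) \<in> (M, X, \<kappa>) <#\<^bsub>jacobi_group1\<^esub> SO2_in_group1
    \<longleftrightarrow> (\<exists>R. rotation_matrix R \<and> N = M ** R \<and> Y = X v* R \<and> k = \<kappa>)"
  by (auto simp: l_coset_def jacobi_group1_def SO2_in_group1_def)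


section \<open>Coordinates of a group element and of its coset\<close>

definition group0_coords :: "(real^2^2) \<times> (real^2) \<Rightarrow> real \<times> real \<times> real \<times> real" where
  "group0_coords = (\<lambda>(M, X). case iwasawa_xy M of (x, y) \<Rightarrow>
     (x, y, (X v* matrix_inv M) $ 1, (X v* matrix_inv M) $ 2))"

definition group1_coords ::
  "(real^2^2) \<times> (real^2) \<times> real \<Rightarrow> real \<times> real \<times> real \<times> real \<times> real" where
  "group1_coords = (\<lambda>(M, X, \<kappa>). case group0_coords (M, X) of (x, y, p, q) \<Rightarrow> (x, y, p, q, \<kappa>))"

text \<open>
  The standard representative of a coset: the member for which the angle \<open>\<theta>\<close> is zero.
\<close>

definition section0 :: "real \<times> real \<times> real \<times> real \<Rightarrow> (real^2^2) \<times> (real^2)" where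
  "section0 = (\<lambda>(x, y, p, q). (upper_tri x y, vector [p, q] v* upper_tri x y))"

definition section1 :: "real \<times> real \<times> real \<times> real \<times> real \<Rightarrow> (real^2^2) \<times> (real^2) \<times> real" where
  "section1 = (\<lambda>(x, y, p, q, \<kappa>). (upper_tri x y, vector [p, q] v* upper_tri x y, \<kappa>))"

text \<open>
  The condition that defines the coordinates of a coset holds at each of its members for exactly
  the same values: \<open>x\<close> and \<open>y\<close> are rotation invariant, and \<open>(X R) (M R)\<^sup>-\<^sup>1 = X M\<^sup>-\<^sup>1\<close>.
\<close>

lemma coords_witness_iff:
  fixes M R :: "real^2^2" and X :: "real^2"
  assumes M: "det M = 1" and R: "rotation_matrix R"
  shows "(\<exists>\<theta>. iwasawa (M ** R) x y \<theta> \<and> vector [p, q] = (X v* R) v* matrix_inv (M ** R))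
    \<longleftrightarrow> (x, y, p, q) = group0_coords (M, X)"
proof -
  have MR: "det (M ** R) = 1"
    using assms by (simp add: det_mul rotation_matrix_def)
  have xy: "(\<exists>\<theta>. iwasawa (M ** R) x y \<theta>) \<longleftrightarrow> (x, y) = iwasawa_xy M"
    using ex_iwasawa_iff[OF MR, of x y] iwasawa_xy_mult_rotation[OF R, of M] by (simp only: eq_commute)
  have pq: "(X v* R) v* matrix_inv (M ** R) = X v* matrix_inv M"
    unfolding vector_matrix_inv_eq_iff[OF MR]
    by (simp add: vector_matrix_mul_assoc matrix_mul_assoc det_1_inverse M)
  have vec: "vector [p, q] = v \<longleftrightarrow> p = v $ 1 \<and> q = v $ 2" for v :: "real^2"
    by (simp add: vec_eq_iff forall_2)
  obtain x0 y0 where xy0: "iwasawa_xy M = (x0, y0)"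
    by (rule prod.exhaust)
  show ?thesis
    by (simp only: ex_simps xy pq vec group0_coords_def split xy0 prod.inject conj_assoc)
qed

lemma ex_rotation_coords_iff:
  fixes M :: "real^2^2" and X :: "real^2"
  assumes M: "det M = 1"
  shows "(\<exists>R. rotation_matrix R \<and> (\<exists>\<theta>. iwasawa (M ** R) x y \<theta>
      \<and> vector [p, q] = (X v* R) v* matrix_inv (M ** R)))
    \<longleftrightarrow> (x, y, p, q) = group0_coords (M, X)" (is "(\<exists>R. _ \<and> ?W R) \<longleftrightarrow> ?C")
proof
  assume "\<exists>R. rotation_matrix R \<and> ?W R"
  then obtain R where *: "rotation_matrix R \<and> ?W R"
    by (rule exE)
  from *[THEN conjunct2] show ?C
    by (simp only: coords_witness_iff[OF M *[THEN conjunct1]])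
next
  assume ?C
  then have "?W (rotation2 0)"
    by (simp only: coords_witness_iff[OF M rotation_matrix_rotation2])
  then show "\<exists>R. rotation_matrix R \<and> ?W R"
    by (intro exI[of _ "rotation2 0"] conjI rotation_matrix_rotation2)
qed

text \<open>
  The elements of a coset are parametrised by rotations, and this turns a quantifier over the
  elements into one over rotations.
\<close>

lemma ex_pair_parametrized_iff:
  "(\<exists>N Y \<theta>. (\<exists>R. A R \<and> N = f R \<and> Y = h R) \<and> B N Y \<theta> \<and> C N Y)
    \<longleftrightarrow> (\<exists>R. A R \<and> (\<exists>\<theta>. B (f R) (h R) \<theta> \<and> C (f R) (h R)))"
  by blast

lemma SJ_coords_lcoset:
  assumes "g \<in> carrier jacobi_group0"
  shows "SJ_coords (g <#\<^bsub>jacobi_group0\<^esub> SO2_in_group0) = group0_coords g"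
proof -
  obtain M X where g: "g = (M, X)" and M: "det M = 1"
    using assms by (auto simp: jacobi_group0_def)
  let ?W = "\<lambda>x y p q. \<exists>N Y \<theta>. (N, Y) \<in> g <#\<^bsub>jacobi_group0\<^esub> SO2_in_group0
    \<and> iwasawa N x y \<theta> \<and> vector [p, q] = Y v* matrix_inv N"
  have "?W x y p q \<longleftrightarrow> (x, y, p, q) = group0_coords g" for x y p q
    unfolding g mem_lcoset_group0 ex_rotation_coords_iff[OF M, symmetric]
    by (rule ex_pair_parametrized_iff)
  then have "(case v of (x, y, p, q) \<Rightarrow> ?W x y p q) \<longleftrightarrow> v = group0_coords g" for v
    by (cases v) (simp only: split)
  then have "(\<lambda>(x, y, p, q). ?W x y p q) = (\<lambda>v. v = group0_coords g)"
    by (rule ext)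
  from arg_cong[OF this, of The] show ?thesis
    unfolding SJ_coords_def the_eq_trivial .
qed

lemma ext_SJ_coords_lcoset:
  assumes "g \<in> carrier jacobi_group1"
  shows "ext_SJ_coords (g <#\<^bsub>jacobi_group1\<^esub> SO2_in_group1) = group1_coords g"
proof -
  obtain M X \<kappa> where g: "g = (M, X, \<kappa>)" and M: "det M = 1"
    using assms by (auto simp: jacobi_group1_def)
  let ?W = "\<lambda>x y p q k. \<exists>N Y \<theta>. (N, Y, k) \<in> g <#\<^bsub>jacobi_group1\<^esub> SO2_in_group1
    \<and> iwasawa N x y \<theta> \<and> vector [p, q] = Y v* matrix_inv N"
  have "?W x y p q k \<longleftrightarrow> (x, y, p, q) = group0_coords (M, X) \<and> k = \<kappa>" for x y p q k
  proof (cases "k = \<kappa>")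
    case True
    then show ?thesis
      unfolding g mem_lcoset_group1 ex_rotation_coords_iff[OF M, symmetric]
      by (simp only: simp_thms) (rule ex_pair_parametrized_iff)
  qed (simp add: g mem_lcoset_group1)
  moreover have "(x, y, p, q) = group0_coords (M, X) \<and> k = \<kappa> \<longleftrightarrow> (x, y, p, q, k) = group1_coords g"
    for x y p q k
    by (cases "group0_coords (M, X)") (simp add: g group1_coords_def)
  ultimately have "(case v of (x, y, p, q, k) \<Rightarrow> ?W x y p q k) \<longleftrightarrow> v = group1_coords g" for v
    by (cases v) (simp only: split)
  then have "(\<lambda>(x, y, p, q, k). ?W x y p q k) = (\<lambda>v. v = group1_coords g)"
    by (rule ext)
  from arg_cong[OF this, of The] show ?thesis
    unfolding ext_SJ_coords_def the_eq_trivial .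
qed

text \<open>
  Every group element is its standard representative times a rotation, where the rotation is the
  last Iwasawa factor of \<open>M\<close>.
\<close>

lemma group0_coords_decomposition:
  fixes M :: "real^2^2" and X :: "real^2"
  assumes M: "det M = 1" and coords: "group0_coords (M, X) = (x, y, p, q)"
  obtains R where "rotation_matrix R" "y > 0" "M = upper_tri x y ** R"
    "X = vector [p, q] v* upper_tri x y v* R"
proof -
  have "rotation_matrix (mat 1 :: real^2^2)"
    by (simp add: rotation_matrix_def orthogonal_matrix_id)
  from coords_witness_iff[OF M this, of x y p q X] coords
  obtain \<theta> where "iwasawa M x y \<theta>" and pq: "X v* matrix_inv M = vector [p, q]"
    by auto
  then have y: "y > 0" and MT: "M = upper_tri x y ** rotation2 \<theta>"
    by (auto simp: iwasawa_iff)
  have "X = vector [p, q] v* M"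
    using pq by (simp only: vector_matrix_inv_eq_iff[OF M])
  then have "X = vector [p, q] v* upper_tri x y v* rotation2 \<theta>"
    by (simp only: MT vector_matrix_mul_assoc)
  with rotation_matrix_rotation2 y MT show ?thesis
    by (rule that)
qed

lemma section0_carrier: "y > 0 \<Longrightarrow> section0 (x, y, p, q) \<in> carrier jacobi_group0"
  by (simp add: section0_def jacobi_group0_def det_upper_tri)

lemma section1_carrier: "y > 0 \<Longrightarrow> section1 (x, y, p, q, \<kappa>) \<in> carrier jacobi_group1"
  by (simp add: section1_def jacobi_group1_def det_upper_tri)

lemma group0_coords_section0: "y > 0 \<Longrightarrow> group0_coords (section0 (x, y, p, q)) = (x, y, p, q)"
  by (simp add: group0_coords_def section0_def iwasawa_xy_upper_tri vector_matrix_mul_assoc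
      det_1_inverse det_upper_tri)

lemma group1_coords_section1:
  "y > 0 \<Longrightarrow> group1_coords (section1 (x, y, p, q, \<kappa>)) = (x, y, p, q, \<kappa>)"
  using group0_coords_section0[of y x p q]
  by (simp add: group1_coords_def section1_def section0_def)

lemma lcoset_section0:
  assumes "g \<in> carrier jacobi_group0"
  shows "section0 (group0_coords g) <#\<^bsub>jacobi_group0\<^esub> SO2_in_group0
    = g <#\<^bsub>jacobi_group0\<^esub> SO2_in_group0"
proof -
  obtain M X where g: "g = (M, X)" and M: "det M = 1"
    using assms by (auto simp: jacobi_group0_def)
  obtain x y p q where coords: "group0_coords (M, X) = (x, y, p, q)"
    by (metis prod_cases4)
  obtain R where R: "rotation_matrix R" "y > 0" "M = upper_tri x y ** R"
    "X = vector [p, q] v* upper_tri x y v* R"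
    using group0_coords_decomposition[OF M coords] .
  have "g \<in> section0 (x, y, p, q) <#\<^bsub>jacobi_group0\<^esub> SO2_in_group0"
    unfolding g section0_def split mem_lcoset_group0 using R by blast
  then show ?thesis
    unfolding g coords
    by (rule group.l_repr_independence[OF group_jacobi_group0])
       (simp_all add: section0_carrier R subgroup_SO2_group0)
qed

lemma lcoset_section1:
  assumes "g \<in> carrier jacobi_group1"
  shows "section1 (group1_coords g) <#\<^bsub>jacobi_group1\<^esub> SO2_in_group1
    = g <#\<^bsub>jacobi_group1\<^esub> SO2_in_group1"
proof -
  obtain M X \<kappa> where g: "g = (M, X, \<kappa>)" and M: "det M = 1"
    using assms by (auto simp: jacobi_group1_def)
  obtain x y p q where coords: "group0_coords (M, X) = (x, y, p, q)"
    by (metis prod_cases4)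
  obtain R where R: "rotation_matrix R" "y > 0" "M = upper_tri x y ** R"
    "X = vector [p, q] v* upper_tri x y v* R"
    using group0_coords_decomposition[OF M coords] .
  have coords1: "group1_coords (M, X, \<kappa>) = (x, y, p, q, \<kappa>)"
    by (simp add: group1_coords_def coords)
  have "g \<in> section1 (x, y, p, q, \<kappa>) <#\<^bsub>jacobi_group1\<^esub> SO2_in_group1"
    unfolding g section1_def split mem_lcoset_group1 using R by blast
  then show ?thesis
    unfolding g coords1
    by (rule group.l_repr_independence[OF group_jacobi_group1])
       (simp_all add: section1_carrier R subgroup_SO2_group1)
qed

lemma group0_coords_range:
  assumes "g \<in> carrier jacobi_group0"
  shows "group0_coords g \<in> {(x, y, p, q). y > 0}"
  using assms row_2_pos by (auto simp: jacobi_group0_def group0_coords_def iwasawa_xy_def)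

lemma group1_coords_range:
  assumes "g \<in> carrier jacobi_group1"
  shows "group1_coords g \<in> {(x, y, p, q, \<kappa>). y > 0}"
  using assms row_2_pos
  by (auto simp: jacobi_group1_def group1_coords_def group0_coords_def iwasawa_xy_def)

lemma bij_betw_SJ_coords: "bij_betw SJ_coords SJ_space {(x, y, p, q). y > 0}"
  unfolding SJ_space_def
  by (rule group.bij_betw_lcosets_section[OF group_jacobi_group0,
        where f = group0_coords and s = section0])
     (auto simp: SJ_coords_lcoset lcoset_section0 section0_carrier group0_coords_section0
       dest: group0_coords_range)

lemma bij_betw_ext_SJ_coords: "bij_betw ext_SJ_coords ext_SJ_space {(x, y, p, q, \<kappa>). y > 0}"
  unfolding ext_SJ_space_def
  by (rule group.bij_betw_lcosets_section[OF group_jacobi_group1,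
        where f = group1_coords and s = section1])
     (auto simp: ext_SJ_coords_lcoset lcoset_section1 section1_carrier group1_coords_section1
       dest: group1_coords_range)

text \<open>
  Since \<open>p\<close> and \<open>q\<close> are real, \<open>p\<close> is recovered from \<open>Im z = p Im \<tau>\<close>, and then \<open>q\<close> from \<open>Re z\<close>.
\<close>

lemma bij_betw_complex_coords:
  "bij_betw (\<lambda>(x, y, p, q). (Complex x y, of_real p * Complex x y + of_real q))
     {(x, y, p, q). y > 0} {(\<tau>, z). Im \<tau> > 0}"
  by (rule bij_betw_byWitness[where
        f' = "\<lambda>(\<tau>, z). (Re \<tau>, Im \<tau>, Im z / Im \<tau>, Re z - Im z / Im \<tau> * Re \<tau>)"])
     (auto simp: complex_eq_iff)

lemma bij_betw_SJ_complex_coords: "bij_betw SJ_complex_coords SJ_space {(\<tau>, z). Im \<tau> > 0}"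
proof -
  have "SJ_complex_coords
      = (\<lambda>(x, y, p, q). (Complex x y, of_real p * Complex x y + of_real q)) \<circ> SJ_coords"
    by (simp add: fun_eq_iff SJ_complex_coords_def)
  then show ?thesis
    using bij_betw_trans[OF bij_betw_SJ_coords bij_betw_complex_coords] by simp
qed

lemma bij_betw_ext_SJ_complex_coords:
  "bij_betw ext_SJ_complex_coords ext_SJ_space {(\<tau>, z, \<kappa>). Im \<tau> > 0}"
proof -
  have bij: "bij_betw (\<lambda>(x, y, p, q, \<kappa>). (Complex x y, of_real p * Complex x y + of_real q, \<kappa>))
     {(x, y, p, q, \<kappa>). y > 0} {(\<tau>, z, \<kappa>::real). Im \<tau> > 0}"
    by (rule bij_betw_byWitness[where
          f' = "\<lambda>(\<tau>, z, \<kappa>). (Re \<tau>, Im \<tau>, Im z / Im \<tau>, Re z - Im z / Im \<tau> * Re \<tau>, \<kappa>)"])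
       (auto simp: complex_eq_iff)
  have "ext_SJ_complex_coords
      = (\<lambda>(x, y, p, q, \<kappa>). (Complex x y, of_real p * Complex x y + of_real q, \<kappa>)) \<circ> ext_SJ_coords"
    by (simp add: fun_eq_iff ext_SJ_complex_coords_def)
  then show ?thesis
    using bij_betw_trans[OF bij_betw_ext_SJ_coords bij] by simp
qed

section \<open>The actions in coordinates\<close>

lemma group_action_SJ: "group_action jacobi_group0 SJ_space SJ_action"
  using group.group_action_lcosets[OF group_jacobi_group0 subgroup_SO2_group0]
  by (simp add: SJ_space_def SJ_action_def[abs_def])

lemma group_action_ext_SJ: "group_action jacobi_group1 ext_SJ_space ext_SJ_action"
  using group.group_action_lcosets[OF group_jacobi_group1 subgroup_SO2_group1]
  by (simp add: ext_SJ_space_def ext_SJ_action_def[abs_def])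

lemma SJ_coords_action:
  assumes "g \<in> carrier jacobi_group0" "P \<in> SJ_space"
  shows "SJ_coords (SJ_action g P) = group0_coords (g \<otimes>\<^bsub>jacobi_group0\<^esub> section0 (SJ_coords P))"
proof -
  have "SJ_action g P = g <#\<^bsub>jacobi_group0\<^esub> P"
    using assms by (simp add: SJ_action_def)
  moreover have "section0 v \<in> carrier jacobi_group0" if "v \<in> {(x, y, p, q). y > 0}" for v
    using that by (auto simp: section0_carrier)
  ultimately show ?thesis
    using group.coords_left_mult_section[OF group_jacobi_group0 subgroup_SO2_group0
        SJ_coords_lcoset group0_coords_range _ lcoset_section0] assms
    unfolding SJ_space_def by metis
qed

lemma ext_SJ_coords_action:
  assumes "g \<in> carrier jacobi_group1" "P \<in> ext_SJ_space"
  shows "ext_SJ_coords (ext_SJ_action g P)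
    = group1_coords (g \<otimes>\<^bsub>jacobi_group1\<^esub> section1 (ext_SJ_coords P))"
proof -
  have "ext_SJ_action g P = g <#\<^bsub>jacobi_group1\<^esub> P"
    using assms by (simp add: ext_SJ_action_def)
  moreover have "section1 v \<in> carrier jacobi_group1" if "v \<in> {(x, y, p, q, \<kappa>). y > 0}" for v
    using that by (auto simp: section1_carrier)
  ultimately show ?thesis
    using group.coords_left_mult_section[OF group_jacobi_group1 subgroup_SO2_group1
        ext_SJ_coords_lcoset group1_coords_range _ lcoset_section1] assms
    unfolding ext_SJ_space_def by metis
qed

text \<open>
  The pair \<open>(p, q)\<close> transforms affinely because of
  \<open>(X M' + X') (M M')\<^sup>-\<^sup>1 = X M\<^sup>-\<^sup>1 + (X' M'\<^sup>-\<^sup>1) M\<^sup>-\<^sup>1\<close>.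
\<close>

lemma group0_coords_mult_section0:
  fixes a b c d x y p q p' q' :: real and X :: "real^2"
  assumes det: "a * d - b * c = 1" and y: "y > 0"
    and pq: "vector [p, q] = X v* matrix_inv (vector [vector [a, b], vector [c, d]] :: real^2^2)"
  shows "group0_coords ((vector [vector [a, b], vector [c, d]], X)
      \<otimes>\<^bsub>jacobi_group0\<^esub> section0 (x, y, p', q'))
    = (((a * x + b) * (c * x + d) + a * c * y^2) / ((c * x + d)^2 + (c * y)^2),
       y / ((c * x + d)^2 + (c * y)^2), p + d * p' - c * q', q - b * p' + a * q')"
proof -
  define M :: "real^2^2" where "M = vector [vector [a, b], vector [c, d]]"
  have M: "det M = 1"
    using det by (simp add: M_def det_2)
  have T: "det (upper_tri x y) = 1"
    using y by (rule det_upper_tri)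
  have "X = vector [p, q] v* M"
    using vector_matrix_inv_eq_iff[OF M, of X "vector [p, q]"] pq[folded M_def] by simp
  moreover have "vector [p', q'] = (vector [p' * d - q' * c, q' * a - p' * b] v* M :: real^2)"
    using vector_matrix_inv_2[OF det, of p' q'] unfolding M_def[symmetric]
    by (simp only: vector_matrix_inv_eq_iff[OF M])
  ultimately have "X v* upper_tri x y + vector [p', q'] v* upper_tri x y
      = (vector [p, q] + vector [p' * d - q' * c, q' * a - p' * b]) v* (M ** upper_tri x y)"
    by (simp only: vector_matrix_mul_assoc vector_matrix_left_distrib)
  then have pq1: "(X v* upper_tri x y + vector [p', q'] v* upper_tri x y)
      v* matrix_inv (M ** upper_tri x y)
    = vector [p, q] + vector [p' * d - q' * c, q' * a - p' * b]"
    by (simp only: vector_matrix_inv_eq_iff det_mul M T mult_1)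
  have "(M, X) \<otimes>\<^bsub>jacobi_group0\<^esub> section0 (x, y, p', q')
      = (M ** upper_tri x y, X v* upper_tri x y + vector [p', q'] v* upper_tri x y)"
    by (simp add: section0_def jacobi_group0_def)
  then show ?thesis
    by (simp add: group0_coords_def pq1 flip: M_def)
       (simp add: M_def iwasawa_xy_mult_upper_tri[OF y] mult.commute)
qed

text \<open>
  With the standard representative \<open>(T, (p', q') T)\<close> as second factor, the cocycle is the
  symplectic form of \<open>(\<lambda>, \<mu>) T\<close> and \<open>(p', q') T\<close>, hence that of \<open>(\<lambda>, \<mu>)\<close> and \<open>(p', q')\<close>.
\<close>

lemma group1_coords_mult_section1:
  assumes "y > 0"
    and "group0_coords ((M, vector [lam, \<mu>]) \<otimes>\<^bsub>jacobi_group0\<^esub> section0 (x, y, p', q'))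
      = (x1, y1, p1, q1)"
  shows "group1_coords ((M, vector [lam, \<mu>], \<kappa>) \<otimes>\<^bsub>jacobi_group1\<^esub> section1 (x, y, p', q', \<kappa>'))
    = (x1, y1, p1, q1, \<kappa> + \<kappa>' + lam * q' - \<mu> * p')"
  using assms
  by (simp add: group1_coords_def section1_def section0_def jacobi_group0_def jacobi_group1_def
      det_vector_rows_mult det_upper_tri)
     (simp add: det_2)

lemma moebius_real_coords:
  fixes a b c d x y :: real
  assumes det: "a * d - b * c = 1" and y: "y > 0"
  shows "(of_real c * Complex x y + of_real d :: complex) \<noteq> 0"
    and "(of_real a * Complex x y + of_real b) / (of_real c * Complex x y + of_real d)
      = Complex (((a * x + b) * (c * x + d) + a * c * y^2) / ((c * x + d)^2 + (c * y)^2))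
          (y / ((c * x + d)^2 + (c * y)^2))"
proof -
  have "c \<noteq> 0 \<or> d \<noteq> 0"
    using det by auto
  then show "(of_real c * Complex x y + of_real d :: complex) \<noteq> 0"
    using y by (auto simp: complex_eq_iff)
  have "a * y * (c * x + d) - (a * x + b) * (c * y) = y"
    using det by algebra
  then show "(of_real a * Complex x y + of_real b) / (of_real c * Complex x y + of_real d)
      = Complex (((a * x + b) * (c * x + d) + a * c * y^2) / ((c * x + d)^2 + (c * y)^2))
          (y / ((c * x + d)^2 + (c * y)^2))"
    by (simp add: complex_eq_iff Re_divide Im_divide power2_eq_square algebra_simps)
qed

text \<open>
  The fibre coordinate \<open>z = p \<tau> + q\<close> pairs the row \<open>(p, q)\<close> with the column \<open>(\<tau>, 1)\<close>. Under the
  action the row becomes \<open>((\<lambda>, \<mu>) + (p', q')) M\<^sup>-\<^sup>1\<close>, while the column becomes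
  \<open>M (\<tau>, 1) / (c \<tau> + d)\<close>. So \<open>M\<close> cancels, and only the automorphy factor \<open>c \<tau> + d\<close> remains.
\<close>

lemma moebius_fibre_coord:
  fixes a b c d p q p' q' :: real and \<tau> :: complex
  assumes "of_real c * \<tau> + of_real d \<noteq> 0" and "a * d - b * c = 1"
    and "lam = p * a + q * c" and "\<mu> = p * b + q * d"
  shows "of_real (p + d * p' - c * q') * ((of_real a * \<tau> + of_real b) / (of_real c * \<tau> + of_real d))
      + of_real (q - b * p' + a * q')
    = (of_real p' * \<tau> + of_real q' + of_real lam * \<tau> + of_real \<mu>) / (of_real c * \<tau> + of_real d)"
proof -
  have "of_real a * of_real d - of_real b * of_real c = (1 :: complex)"
    using assms(2) by (metis of_real_1 of_real_diff of_real_mult)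
  then have "of_real (p + d * p' - c * q') * (of_real a * \<tau> + of_real b)
      + of_real (q - b * p' + a * q') * (of_real c * \<tau> + of_real d)
    = of_real p' * \<tau> + of_real q' + of_real lam * \<tau> + of_real \<mu>"
    unfolding assms(3,4) of_real_add of_real_diff of_real_mult by algebra
  then show ?thesis
    using assms(1) by (simp add: field_simps)
qed

lemma action_coordinates:
  fixes a b c d lam \<mu> p q x' y' p' q' :: real and M :: "real^2^2" and X :: "real^2"
  assumes M: "det M = 1" and Mabcd: "M = vector [vector [a, b], vector [c, d]]"
    and X: "X = vector [lam, \<mu>]" and pq: "vector [p, q] = X v* matrix_inv M"
    and y': "y' > 0" and \<tau>: "\<tau> = Complex x' y'" and z: "z = of_real p' * \<tau> + of_real q'"
  defines "x1 \<equiv> ((a * x' + b) * (c * x' + d) + a * c * y'^2) / ((c * x' + d)^2 + (c * y')^2)"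
    and "y1 \<equiv> y' / ((c * x' + d)^2 + (c * y')^2)"
    and "p1 \<equiv> p + d * p' - c * q'" and "q1 \<equiv> q - b * p' + a * q'"
  shows "group0_coords ((M, X) \<otimes>\<^bsub>jacobi_group0\<^esub> section0 (x', y', p', q')) = (x1, y1, p1, q1)"
    and "Complex x1 y1 = (of_real a * \<tau> + of_real b) / (of_real c * \<tau> + of_real d)"
    and "of_real p1 * Complex x1 y1 + of_real q1
      = (z + of_real lam * \<tau> + of_real \<mu>) / (of_real c * \<tau> + of_real d)"
    and "of_real x1 + \<i> * of_real y1
      = (of_real ((a * x' + b) * (c * x' + d) + a * c * y'^2) + \<i> * of_real y')
        / of_real ((c * x' + d)^2 + (c * y')^2)"
    and "(vector [p1, q1] :: real^2) = vector [p, q] + vector [p', q'] v* matrix_inv M"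
proof -
  have det: "a * d - b * c = 1"
    using M by (simp add: Mabcd det_2)
  show "group0_coords ((M, X) \<otimes>\<^bsub>jacobi_group0\<^esub> section0 (x', y', p', q')) = (x1, y1, p1, q1)"
    unfolding x1_def y1_def p1_def q1_def Mabcd
    by (rule group0_coords_mult_section0[OF det y' pq[unfolded Mabcd]])
  show *: "Complex x1 y1 = (of_real a * \<tau> + of_real b) / (of_real c * \<tau> + of_real d)"
    unfolding \<tau> x1_def y1_def by (rule moebius_real_coords(2)[OF det y', symmetric])
  have "X = vector [p, q] v* M"
    using vector_matrix_inv_eq_iff[OF M, of X "vector [p, q]"] pq by simp
  then have lam: "lam = p * a + q * c" "\<mu> = p * b + q * d"
    by (simp_all add: X Mabcd mat2_simps)
  show "of_real p1 * Complex x1 y1 + of_real q1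
      = (z + of_real lam * \<tau> + of_real \<mu>) / (of_real c * \<tau> + of_real d)"
    unfolding * z p1_def q1_def
    using moebius_real_coords(1)[OF det y', of x'] unfolding \<tau>
    by (rule moebius_fibre_coord[OF _ det lam])
  show "of_real x1 + \<i> * of_real y1
      = (of_real ((a * x' + b) * (c * x' + d) + a * c * y'^2) + \<i> * of_real y')
        / of_real ((c * x' + d)^2 + (c * y')^2)"
    unfolding x1_def y1_def by (simp add: add_divide_distrib)
  show "(vector [p1, q1] :: real^2) = vector [p, q] + vector [p', q'] v* matrix_inv M"
    unfolding Mabcd vector_matrix_inv_2[OF det]
    by (simp add: vec_eq_iff forall_2 p1_def q1_def mult.commute)
qed

lemma SJ_coords_pos:
  assumes "P \<in> SJ_space" "SJ_coords P = (x, y, p, q)"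
  shows "y > 0"
  using bij_betwE[OF bij_betw_SJ_coords] assms by fastforce

lemma ext_SJ_coords_pos:
  assumes "P \<in> ext_SJ_space" "ext_SJ_coords P = (x, y, p, q, \<kappa>)"
  shows "y > 0"
  using bij_betwE[OF bij_betw_ext_SJ_coords] assms by fastforce


section \<open>The actions of the two Jacobi groups\<close>

theorem lemma5p1:
  shows
  "(group_action jacobi_group0 SJ_space SJ_action
    \<and> bij_betw SJ_coords SJ_space {(x, y, p, q). y > 0}
    \<and> bij_betw SJ_complex_coords SJ_space {(\<tau>, z). Im \<tau> > 0}
    \<and> (\<forall>(M::real^2^2) (X::real^2) (a::real) (b::real) (c::real) (d::real)
          (lam::real) (\<mu>::real) (p::real) (q::real) P
          (x'::real) (y'::real) (p'::real) (q'::real) (\<tau>'::complex) (z'::complex).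
        (M, X) \<in> carrier jacobi_group0
        \<and> M = vector [vector [a, b], vector [c, d]] \<and> X = vector [lam, \<mu>]
        \<and> vector [p, q] = X v* matrix_inv M
        \<and> P \<in> SJ_space
        \<and> SJ_coords P = (x', y', p', q') \<and> SJ_complex_coords P = (\<tau>', z')
        \<longrightarrow> (\<exists>x1 y1 p1 q1 \<tau>1 z1.
              SJ_complex_coords (SJ_action (M, X) P) = (\<tau>1, z1)
              \<and> \<tau>1 = (of_real a * \<tau>' + of_real b) / (of_real c * \<tau>' + of_real d)
              \<and> z1 = (z' + of_real lam * \<tau>' + of_real \<mu>) / (of_real c * \<tau>' + of_real d)
              \<and> SJ_coords (SJ_action (M, X) P) = (x1, y1, p1, q1)
              \<and> of_real x1 + \<i> * of_real y1
                 = (of_real ((a * x' + b) * (c * x' + d) + a * c * y'^2) + \<i> * of_real y')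
                   / of_real ((c * x' + d)^2 + (c * y')^2)
              \<and> (vector [p1, q1] :: real^2)
                 = vector [p, q] + vector [p', q'] v* matrix_inv M
              \<and> (p1, q1) = (p + d * p' - c * q', q - b * p' + a * q'))))
   \<and>
   (group_action jacobi_group1 ext_SJ_space ext_SJ_action
    \<and> bij_betw ext_SJ_coords ext_SJ_space {(x, y, p, q, \<kappa>). y > 0}
    \<and> bij_betw ext_SJ_complex_coords ext_SJ_space {(\<tau>, z, \<kappa>). Im \<tau> > 0}
    \<and> (\<forall>(M::real^2^2) (X::real^2) (\<kappa>::real) (a::real) (b::real) (c::real) (d::real)
          (lam::real) (\<mu>::real) (p::real) (q::real) P
          (x'::real) (y'::real) (p'::real) (q'::real) (\<kappa>'::real) (\<tau>'::complex) (z'::complex)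
          (\<xi>'::real) (\<eta>'::real).
        (M, X, \<kappa>) \<in> carrier jacobi_group1
        \<and> M = vector [vector [a, b], vector [c, d]] \<and> X = vector [lam, \<mu>]
        \<and> vector [p, q] = X v* matrix_inv M
        \<and> P \<in> ext_SJ_space
        \<and> ext_SJ_coords P = (x', y', p', q', \<kappa>') \<and> ext_SJ_complex_coords P = (\<tau>', z', \<kappa>')
        \<and> z' = of_real \<xi>' + \<i> * of_real \<eta>'
        \<longrightarrow> (\<exists>x1 y1 p1 q1 \<tau>1 z1 \<kappa>1.
              ext_SJ_complex_coords (ext_SJ_action (M, X, \<kappa>) P) = (\<tau>1, z1, \<kappa>1)
              \<and> \<tau>1 = (of_real a * \<tau>' + of_real b) / (of_real c * \<tau>' + of_real d)
              \<and> z1 = (z' + of_real lam * \<tau>' + of_real \<mu>) / (of_real c * \<tau>' + of_real d)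
              \<and> ext_SJ_coords (ext_SJ_action (M, X, \<kappa>) P) = (x1, y1, p1, q1, \<kappa>1)
              \<and> of_real x1 + \<i> * of_real y1
                 = (of_real ((a * x' + b) * (c * x' + d) + a * c * y'^2) + \<i> * of_real y')
                   / of_real ((c * x' + d)^2 + (c * y')^2)
              \<and> (vector [p1, q1] :: real^2)
                 = vector [p, q] + vector [p', q'] v* matrix_inv M
              \<and> (p1, q1) = (p + d * p' - c * q', q - b * p' + a * q')
              \<and> \<kappa>1 = \<kappa> + \<kappa>' + lam * q' - \<mu> * p'
              \<and> (p', q') = (\<eta>' / y', \<xi>' - x' / y' * \<eta>'))))"
proof (intro conjI allI impI group_action_SJ bij_betw_SJ_coords bij_betw_SJ_complex_coords
    group_action_ext_SJ bij_betw_ext_SJ_coords bij_betw_ext_SJ_complex_coords, goal_cases)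
  case (1 M X a b c d lam \<mu> p q P x' y' p' q' \<tau>' z')
  then have g: "(M, X) \<in> carrier jacobi_group0"
    and M: "M = vector [vector [a, b], vector [c, d]]" and X: "X = vector [lam, \<mu>]"
    and pq: "vector [p, q] = X v* matrix_inv M" and P: "P \<in> SJ_space"
    and P_coords: "SJ_coords P = (x', y', p', q')" and P_complex: "SJ_complex_coords P = (\<tau>', z')"
    by blast+
  have det: "det M = 1"
    using g by (simp add: jacobi_group0_def)
  have \<tau>': "\<tau>' = Complex x' y'" and z': "z' = of_real p' * \<tau>' + of_real q'"
    using P_complex by (auto simp: SJ_complex_coords_def P_coords)
  note formulas = action_coordinates[OF det M X pq SJ_coords_pos[OF P P_coords] \<tau>' z']
  note coords = SJ_coords_action[OF g P, unfolded P_coords formulas(1)]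
  have complex: "SJ_complex_coords (SJ_action (M, X) P)
    = ((of_real a * \<tau>' + of_real b) / (of_real c * \<tau>' + of_real d),
       (z' + of_real lam * \<tau>' + of_real \<mu>) / (of_real c * \<tau>' + of_real d))"
    by (simp only: SJ_complex_coords_def coords split formulas(3)) (simp only: formulas(2))
  show ?case
    by (intro exI conjI) (rule complex coords formulas(4,5) refl)+
next
  case (2 M X \<kappa> a b c d lam \<mu> p q P x' y' p' q' \<kappa>' \<tau>' z' \<xi>' \<eta>')
  then have g: "(M, X, \<kappa>) \<in> carrier jacobi_group1"
    and M: "M = vector [vector [a, b], vector [c, d]]" and X: "X = vector [lam, \<mu>]"
    and pq: "vector [p, q] = X v* matrix_inv M" and P: "P \<in> ext_SJ_space"
    and P_coords: "ext_SJ_coords P = (x', y', p', q', \<kappa>')"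
    and P_complex: "ext_SJ_complex_coords P = (\<tau>', z', \<kappa>')"
    and \<xi>\<eta>: "z' = of_real \<xi>' + \<i> * of_real \<eta>'"
    by blast+
  have det: "det M = 1"
    using g by (simp add: jacobi_group1_def)
  have \<tau>': "\<tau>' = Complex x' y'" and z': "z' = of_real p' * \<tau>' + of_real q'"
    using P_complex by (auto simp: ext_SJ_complex_coords_def P_coords)
  have y': "y' > 0"
    using P P_coords by (rule ext_SJ_coords_pos)
  note formulas = action_coordinates[OF det M X pq y' \<tau>' z']
  note coords = ext_SJ_coords_action[OF g P, unfolded P_coords X
      group1_coords_mult_section1[OF y' formulas(1)[unfolded X]], folded X]
  have complex: "ext_SJ_complex_coords (ext_SJ_action (M, X, \<kappa>) P)
    = ((of_real a * \<tau>' + of_real b) / (of_real c * \<tau>' + of_real d),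
       (z' + of_real lam * \<tau>' + of_real \<mu>) / (of_real c * \<tau>' + of_real d),
       \<kappa> + \<kappa>' + lam * q' - \<mu> * p')"
    by (simp only: ext_SJ_complex_coords_def coords split formulas(3)) (simp only: formulas(2))
  \<comment> \<open>Real and imaginary part of \<open>z' = p' \<tau>' + q'\<close>.\<close>
  have "\<xi>' = p' * x' + q'" "\<eta>' = p' * y'"
    using \<xi>\<eta> by (simp_all add: z' \<tau>' complex_eq_iff)
  then have "(p', q') = (\<eta>' / y', \<xi>' - x' / y' * \<eta>')"
    using y' by simp
  then show ?case
    by (intro exI conjI) (rule complex coords formulas(4,5) refl | assumption)+
qed

end
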